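(* Let $k\ge 0$ and let ${}^kM$ be the extended Kaehlerian manifold ($k$-th order extension of a Kaehlerian manifold $M$ endowed with the closed 2-form $\Phi$), equipped with the closed 2-form $\Phi^{v^k}$. Let $H^{v^k}:{}^kN=\mathbf R\times{}^kM\to\mathbf C$ be the $k$-th order vertical lift of the Hamiltonian $H$ on $N=\mathbf R\times M$, and for each $t\in\mathbf R$ put $H_t=H(t,\cdot)$ and $H_t^{v^k}=H^{v^k}(t,\cdot)$. Let $Z_t$ be the Hamiltonian vector field on $M$ with energy $H_t$, and let $Z_t^{v^k}$ be its $k$-th order vertical lift, which is the time dependent Hamiltonian vector field on ${}^kM$ with energy $H_t^{v^k}$ given by the isomorphism $$i_{Z_t^{v^k}}\Phi^{v^k}=dH_t^{v^k}.$$ Then the $k$-th order vertical lift $Z_t^{v^k}$ of the Hamiltonian vector field $Z_t$ is given by $$Z_t^{v^k}=\frac{1}{\mathbf i}\frac{\partial H^{v^k}}{\partial \overline z_{0i}}\frac{\partial}{\partial z_{ki}}-\frac{1}{\mathbf i}\frac{\partial H^{v^k}}{\partial z_{0i}}\frac{\partial}{\partial\overline z_{ki}}.$$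
   Context: All objects are smooth, repeated indices are summed, $\mathbf i=\sqrt{-1}$, $0\le r\le k$ and $1\le i\le m$. $M$ has complex dimension $m$ and local coordinates $(z_{0i},\overline z_{0i})$. Its $k$-th order extension ${}^kM$ (with ${}^0M=M$) has local coordinates $(z_{ri},\overline z_{ri})$, and ${}^kN=\mathbf R\times{}^kM$ is the $k$-th order extension of $N=\mathbf R\times M$, with coordinates $(t,z_{ri},\overline z_{ri})$ (indices may be written up or down). There are natural projections ${}^kN\to{}^{k-1}N$. Vertical lift of functions: $f^{v^k}$ is the composition of $f$ with the composite natural projection ${}^kN\to N$. Vertical lift of vector fields: the $k$-th order vertical lift to ${}^kM$ of a vector field on $M$ with components $Z_{0i}$ along $\partial/\partial z_{0i}$ and $\overline Z_{0i}$ along $\partial/\partial\overline z_{0i}$ is $$(Z_{0i})^{v^k}\frac{\partial}{\partial z_{ki}}+(\overline Z_{0i})^{v^k}\frac{\partial}{\partial\overline z_{ki}}.$$ Forms: $\Phi=-d\lambda$, where $\lambda$ is the Liouville form on $M$. The closed 2-form $\Phi^{v^k}=-d\lambda^{v^k}$ on ${}^kM$ is the $k$-th order vertical lift of $\Phi$, where $\lambda^{v^k}=\frac12\mathbf i(-z_{0i}\,d\overline z_{0i}+\overline z_{0i}\,dz_{0i})$ is the vertical lift of $\lambda$, so that $\Phi^{v^k}=-\mathbf i\,d\overline z_{0i}\wedge dz_{0i}$. Hamiltonian vector field on $M$: $Z_t$ is given by $i_{Z_t}\Phi=dH_t$ (the case $k=0$ of the equation in the claim).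
   Formalization: For k≥1 the equation i_{Z_t^{v^k}}Φ^{v^k}=dH_t^{v^k} fails literally (the left side is 0); it is proved after carrying Z_t^{v^k} back by ∂/∂z_{ki}→∂/∂z_{0i} and conjugates, and the formula for Z_t^{v^k} is proved without it. *)

theory Defs
  imports "HOL-Analysis.Analysis"
begin


text \<open>
  A point of the coordinate space of the \<open>r\<close>-th order extension is a family \<open>w 0, \<dots>, w r\<close> of
  vectors in \<open>\<complex>\<^sup>m\<close>, where \<open>m = CARD('m)\<close>; it is encoded as an extensional function on \<open>{..r}\<close>,
  so that the level \<open>r\<close> may vary inside a formula.  A chart is a pair of a domain and a coordinate
  map; \<open>snd c p s $ i\<close> is the coordinate \<open>z\<^sub>s\<^sub>i\<close> of \<open>p\<close>.
\<close>

type_synonym ('a, 'm) chart = "'a set \<times> ('a \<Rightarrow> nat \<Rightarrow> complex^'m)"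

text \<open>
  The labels \<open>Hol s i\<close> and \<open>Anti s i\<close> stand for the coordinates \<open>z\<^sub>s\<^sub>i\<close> and their conjugates.
  Complexified tangent vectors and forms at a point are represented by their components with
  respect to the frame \<open>\<partial>/\<partial>z\<^sub>s\<^sub>i\<close>, \<open>\<partial>/\<partial>z\<^sub>s\<^sub>i (conjugate)\<close> and its dual; a 2-form \<open>\<omega>\<close> has components
  \<open>\<omega> a b = \<omega>(\<partial>\<^sub>a, \<partial>\<^sub>b)\<close>.
\<close>

datatype 'm coord = Hol nat 'm | Anti nat 'm

definition labels :: "nat \<Rightarrow> 'm coord set" where
  "labels r = (\<Union>s\<le>r. range (Hol s) \<union> range (Anti s))"

fun coord_fun :: "('a, 'm::finite) chart \<Rightarrow> 'm coord \<Rightarrow> 'a \<Rightarrow> complex" where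
  "coord_fun c (Hol s i) p = snd c p s $ i"
| "coord_fun c (Anti s i) p = cnj (snd c p s $ i)"

definition coord_space :: "nat \<Rightarrow> (nat \<Rightarrow> complex^'m) topology" where
  "coord_space r = product_topology (\<lambda>_. euclidean) {..r}"

text \<open>The point of the chart domain whose \<open>s\<close>-th coordinate block is that of \<open>p\<close> shifted by \<open>v\<close>.\<close>

definition shift :: "('a, 'm::finite) chart \<Rightarrow> nat \<Rightarrow> 'a \<Rightarrow> complex^'m \<Rightarrow> 'a" where
  "shift c s p v = inv_into (fst c) (snd c) ((snd c p)(s := snd c p s + v))"

definition real_pd :: "('a, 'm::finite) chart \<Rightarrow> ('a \<Rightarrow> complex) \<Rightarrow> nat \<Rightarrow> complex^'m \<Rightarrow> 'a \<Rightarrow> complex" where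
  "real_pd c f s v p = vector_derivative (\<lambda>x::real. f (shift c s p (x *\<^sub>R v))) (at 0)"

text \<open>The Wirtinger derivatives \<open>(\<partial>/\<partial>x \<mp> \<i> \<partial>/\<partial>y) / 2\<close>.\<close>

fun pd :: "('a, 'm::finite) chart \<Rightarrow> ('a \<Rightarrow> complex) \<Rightarrow> 'm coord \<Rightarrow> 'a \<Rightarrow> complex" where
  "pd c f (Hol s i) p = (real_pd c f s (axis i 1) p - \<i> * real_pd c f s (axis i \<i>) p) / 2"
| "pd c f (Anti s i) p = (real_pd c f s (axis i 1) p + \<i> * real_pd c f s (axis i \<i>) p) / 2"

text \<open>
  Transition maps are continuous, being composed of homeomorphisms, so by Osgood's lemma separate
  holomorphy in each coordinate makes them holomorphic.
\<close>

definition holomorphic_transition ::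
    "nat \<Rightarrow> ('a, 'm::finite) chart \<Rightarrow> ('a, 'm) chart \<Rightarrow> bool" where
  "holomorphic_transition r c c' \<longleftrightarrow>
     (\<forall>p \<in> fst c \<inter> fst c'. \<forall>s\<le>r. \<forall>i. \<forall>s'\<le>r. \<forall>j.
        (\<lambda>\<zeta>::complex. snd c' (shift c s p (axis i \<zeta>)) s' $ j) field_differentiable (at 0))"

definition complex_manifold :: "nat \<Rightarrow> 'a topology \<Rightarrow> ('a, 'm::finite) chart set \<Rightarrow> bool" where
  "complex_manifold r T A \<longleftrightarrow>
     Hausdorff_space T \<and> second_countable T \<and> (\<Union>c\<in>A. fst c) = topspace T \<and>
     (\<forall>c\<in>A. openin T (fst c) \<and>
        (\<exists>W. openin (coord_space r) W \<and>
          homeomorphic_map (subtopology T (fst c)) (subtopology (coord_space r) W) (snd c))) \<and>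
     (\<forall>c\<in>A. \<forall>c'\<in>A. holomorphic_transition r c c')"



fun Ck_on :: "nat \<Rightarrow> ('a::real_normed_vector \<Rightarrow> 'b::real_normed_vector) \<Rightarrow> 'a set \<Rightarrow> bool" where
  "Ck_on 0 f S \<longleftrightarrow> continuous_on S f"
| "Ck_on (Suc n) f S \<longleftrightarrow>
     f differentiable_on S \<and> (\<forall>v. Ck_on n (\<lambda>x. frechet_derivative f (at x) v) S)"

text \<open>Only used for open \<open>S\<close>.\<close>

definition smooth_on :: "('a::real_normed_vector \<Rightarrow> 'b::real_normed_vector) \<Rightarrow> 'a set \<Rightarrow> bool" where
  "smooth_on f S \<longleftrightarrow> (\<forall>n. Ck_on n f S)"

text \<open>The point of \<open>M\<close> with given coordinates, where \<open>M\<close> is the extension of order 0.\<close>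

definition base_point :: "('a, 'm::finite) chart \<Rightarrow> complex^'m \<Rightarrow> 'a" where
  "base_point c x = inv_into (fst c) (snd c) (\<lambda>s\<in>{..0}. x)"

definition smooth_fun :: "('a, 'm::finite) chart \<Rightarrow> ('a \<Rightarrow> complex) \<Rightarrow> bool" where
  "smooth_fun c f \<longleftrightarrow> smooth_on (\<lambda>x. f (base_point c x)) ((\<lambda>p. snd c p 0) ` fst c)"

text \<open>Smoothness on \<open>N = \<real> \<times> M\<close>.\<close>

definition smooth_hamiltonian :: "('a, 'm::finite) chart set \<Rightarrow> (real \<times> 'a \<Rightarrow> complex) \<Rightarrow> bool" where
  "smooth_hamiltonian A H \<longleftrightarrow>
     (\<forall>c\<in>A. smooth_on (\<lambda>(t, x). H (t, base_point c x)) (UNIV \<times> (\<lambda>p. snd c p 0) ` fst c))"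



text \<open>
  A tensor field on \<open>M\<close> is a family of component functions, one for each chart of the atlas,
  subject to the usual transformation law.
\<close>

definition vector_field ::
    "('a, 'm::finite) chart set \<Rightarrow> (('a, 'm) chart \<Rightarrow> 'a \<Rightarrow> 'm coord \<Rightarrow> complex) \<Rightarrow> bool" where
  "vector_field A V \<longleftrightarrow>
     (\<forall>c\<in>A. \<forall>a\<in>labels 0. smooth_fun c (\<lambda>p. V c p a)) \<and>
     (\<forall>c\<in>A. \<forall>c'\<in>A. \<forall>p \<in> fst c \<inter> fst c'. \<forall>a'\<in>labels 0.
        V c' p a' = (\<Sum>a\<in>labels 0. V c p a * pd c (coord_fun c' a') a p))"

definition two_form ::
    "('a, 'm::finite) chart set \<Rightarrow> (('a, 'm) chart \<Rightarrow> 'a \<Rightarrow> 'm coord \<Rightarrow> 'm coord \<Rightarrow> complex) \<Rightarrow> bool" where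
  "two_form A \<omega> \<longleftrightarrow>
     (\<forall>c\<in>A. \<forall>a\<in>labels 0. \<forall>b\<in>labels 0. smooth_fun c (\<lambda>p. \<omega> c p a b)) \<and>
     (\<forall>c\<in>A. \<forall>p\<in>fst c. \<forall>a\<in>labels 0. \<forall>b\<in>labels 0. \<omega> c p a b = - \<omega> c p b a) \<and>
     (\<forall>c\<in>A. \<forall>c'\<in>A. \<forall>p \<in> fst c \<inter> fst c'. \<forall>a\<in>labels 0. \<forall>b\<in>labels 0.
        \<omega> c p a b = (\<Sum>a'\<in>labels 0. \<Sum>b'\<in>labels 0.
          pd c (coord_fun c' a') a p * pd c (coord_fun c' b') b p * \<omega> c' p a' b'))"

definition closed_two_form ::
    "('a, 'm::finite) chart set \<Rightarrow> (('a, 'm) chart \<Rightarrow> 'a \<Rightarrow> 'm coord \<Rightarrow> 'm coord \<Rightarrow> complex) \<Rightarrow> bool" where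
  "closed_two_form A \<omega> \<longleftrightarrow> two_form A \<omega> \<and>
     (\<forall>c\<in>A. \<forall>p\<in>fst c. \<forall>a\<in>labels 0. \<forall>b\<in>labels 0. \<forall>d\<in>labels 0.
        pd c (\<lambda>q. \<omega> c q b d) a p - pd c (\<lambda>q. \<omega> c q a d) b p + pd c (\<lambda>q. \<omega> c q a b) d p = 0)"

text \<open>
  A closed form \<open>-\<i> \<Sum>ij. h\<^sub>i\<^sub>j dz\<^sub>i (conjugate) \<and> dz\<^sub>j\<close> with \<open>h\<close> Hermitian and positive definite;
  thus \<open>h\<^sub>i\<^sub>j = \<i> \<Phi> (Anti 0 i) (Hol 0 j)\<close>.
\<close>

definition kaehler_form ::
    "('a, 'm::finite) chart set \<Rightarrow> (('a, 'm) chart \<Rightarrow> 'a \<Rightarrow> 'm coord \<Rightarrow> 'm coord \<Rightarrow> complex) \<Rightarrow> bool" where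
  "kaehler_form A \<Phi> \<longleftrightarrow> closed_two_form A \<Phi> \<and>
     (\<forall>c\<in>A. \<forall>p\<in>fst c.
        (\<forall>i j. \<Phi> c p (Hol 0 i) (Hol 0 j) = 0 \<and> \<Phi> c p (Anti 0 i) (Anti 0 j) = 0) \<and>
        (\<forall>i j. \<i> * \<Phi> c p (Anti 0 j) (Hol 0 i) = cnj (\<i> * \<Phi> c p (Anti 0 i) (Hol 0 j))) \<and>
        (\<forall>v::complex^'m. v \<noteq> 0 \<longrightarrow>
           0 < Re (\<Sum>i\<in>UNIV. \<Sum>j\<in>UNIV. \<i> * \<Phi> c p (Anti 0 i) (Hol 0 j) * cnj (v $ i) * v $ j)))"

definition kaehler_manifold ::
    "'a topology \<Rightarrow> ('a, 'm::finite) chart set \<Rightarrow>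
      (('a, 'm) chart \<Rightarrow> 'a \<Rightarrow> 'm coord \<Rightarrow> 'm coord \<Rightarrow> complex) \<Rightarrow> bool" where
  "kaehler_manifold T A \<Phi> \<longleftrightarrow> complex_manifold 0 T A \<and> kaehler_form A \<Phi>"

text \<open>The following operations work in a chart of the extension of order \<open>r\<close>.\<close>

definition ext_d0 :: "('a, 'm::finite) chart \<Rightarrow> nat \<Rightarrow> ('a \<Rightarrow> complex) \<Rightarrow> 'a \<Rightarrow> 'm coord \<Rightarrow> complex" where
  "ext_d0 c r f p a = (if a \<in> labels r then pd c f a p else 0)"

definition ext_d1 :: "('a, 'm::finite) chart \<Rightarrow> nat \<Rightarrow> ('a \<Rightarrow> 'm coord \<Rightarrow> complex) \<Rightarrow>
    'a \<Rightarrow> 'm coord \<Rightarrow> 'm coord \<Rightarrow> complex" where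
  "ext_d1 c r \<omega> p a b =
     (if a \<in> labels r \<and> b \<in> labels r then pd c (\<lambda>q. \<omega> q b) a p - pd c (\<lambda>q. \<omega> q a) b p else 0)"

definition interior_product :: "nat \<Rightarrow> ('m coord \<Rightarrow> complex) \<Rightarrow> ('m coord \<Rightarrow> 'm coord \<Rightarrow> complex) \<Rightarrow>
    'm coord \<Rightarrow> complex" where
  "interior_product r V \<omega> b = (\<Sum>a\<in>labels r. V a * \<omega> a b)"

definition frame :: "'m coord \<Rightarrow> 'm coord \<Rightarrow> complex" where
  "frame a = (\<lambda>b. if b = a then 1 else 0)"

text \<open>The Liouville form \<open>\<lambda> = \<i>/2 \<Sum>i. (- z\<^sub>0\<^sub>i dz\<^sub>0\<^sub>i (conjugate) + z\<^sub>0\<^sub>i (conjugate) dz\<^sub>0\<^sub>i)\<close>.\<close>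

fun liouville :: "('a, 'm::finite) chart \<Rightarrow> 'a \<Rightarrow> 'm coord \<Rightarrow> complex" where
  "liouville c p (Hol s i) = (if s = 0 then (1/2) * \<i> * coord_fun c (Anti 0 i) p else 0)"
| "liouville c p (Anti s i) = (if s = 0 then - (1/2) * \<i> * coord_fun c (Hol 0 i) p else 0)"

definition hamiltonian_field ::
    "('a, 'm::finite) chart set \<Rightarrow> (('a, 'm) chart \<Rightarrow> 'a \<Rightarrow> 'm coord \<Rightarrow> 'm coord \<Rightarrow> complex) \<Rightarrow>
      ('a \<Rightarrow> complex) \<Rightarrow> (('a, 'm) chart \<Rightarrow> 'a \<Rightarrow> 'm coord \<Rightarrow> complex) \<Rightarrow> bool" where
  "hamiltonian_field A \<Phi> f V \<longleftrightarrow> vector_field A V \<and>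
     (\<forall>c\<in>A. \<forall>p\<in>fst c. \<forall>b\<in>labels 0.
        interior_product 0 (V c p) (\<Phi> c p) b = ext_d0 c 0 f p b)"



primrec base_proj :: "(nat \<Rightarrow> 'a \<Rightarrow> 'a) \<Rightarrow> nat \<Rightarrow> 'a \<Rightarrow> 'a" where
  "base_proj pr 0 = id"
| "base_proj pr (Suc r) = base_proj pr r \<circ> pr r"

text \<open>\<open>c'\<close> has as domain the preimage of the domain of \<open>c\<close> and extends the coordinates of \<open>c\<close>.\<close>

definition extends_chart ::
    "'a topology \<Rightarrow> ('a \<Rightarrow> 'a) \<Rightarrow> nat \<Rightarrow> ('a, 'm::finite) chart \<Rightarrow> ('a, 'm) chart \<Rightarrow> bool" where
  "extends_chart T f r c c' \<longleftrightarrow>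
     fst c' = {q \<in> topspace T. f q \<in> fst c} \<and> (\<forall>q\<in>fst c'. \<forall>s\<le>r. snd c' q s = snd c (f q) s)"

text \<open>
  \<open>X r\<close> is the \<open>r\<close>-th order extension of \<open>M = X 0\<close>, with \<open>pr r : X (r + 1) \<rightarrow> X r\<close>.  All spaces are
  carried by subsets of one type, which is no restriction up to homeomorphism.
\<close>

definition extension_tower ::
    "nat \<Rightarrow> (nat \<Rightarrow> 'a topology) \<Rightarrow> (nat \<Rightarrow> ('a, 'm::finite) chart set) \<Rightarrow> (nat \<Rightarrow> 'a \<Rightarrow> 'a) \<Rightarrow> bool" where
  "extension_tower k X A pr \<longleftrightarrow>
     (\<forall>r\<le>k. complex_manifold r (X r) (A r)) \<and>
     (\<forall>r<k. continuous_map (X (Suc r)) (X r) (pr r) \<and>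
        pr r ` topspace (X (Suc r)) = topspace (X r) \<and>
        (\<forall>c\<in>A r. \<exists>c'\<in>A (Suc r). extends_chart (X (Suc r)) (pr r) r c c'))"

definition local_coordinates ::
    "nat \<Rightarrow> (nat \<Rightarrow> 'a topology) \<Rightarrow> (nat \<Rightarrow> ('a, 'm::finite) chart set) \<Rightarrow> (nat \<Rightarrow> 'a \<Rightarrow> 'a) \<Rightarrow>
      (nat \<Rightarrow> ('a, 'm) chart) \<Rightarrow> bool" where
  "local_coordinates k X A pr c \<longleftrightarrow>
     (\<forall>r\<le>k. c r \<in> A r) \<and>
     (\<forall>r<k. extends_chart (X (Suc r)) (pr r) r (c r) (c (Suc r)))"

definition vlift_fun :: "(nat \<Rightarrow> 'a \<Rightarrow> 'a) \<Rightarrow> nat \<Rightarrow> (real \<times> 'a \<Rightarrow> complex) \<Rightarrow> real \<times> 'a \<Rightarrow> complex" where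
  "vlift_fun pr k f = f \<circ> map_prod id (base_proj pr k)"

text \<open>In the lifts of vector fields and 1-forms, \<open>V\<close> and \<open>\<omega>\<close> are components in the base chart.\<close>

definition vlift_field ::
    "(nat \<Rightarrow> 'a \<Rightarrow> 'a) \<Rightarrow> nat \<Rightarrow> ('a \<Rightarrow> 'm::finite coord \<Rightarrow> complex) \<Rightarrow> 'a \<Rightarrow> 'm coord \<Rightarrow> complex" where
  "vlift_field pr k V p = (\<lambda>b.
     (\<Sum>i\<in>UNIV. V (base_proj pr k p) (Hol 0 i) * frame (Hol k i) b) +
     (\<Sum>i\<in>UNIV. V (base_proj pr k p) (Anti 0 i) * frame (Anti k i) b))"

definition vlift_form1 ::
    "(nat \<Rightarrow> 'a \<Rightarrow> 'a) \<Rightarrow> nat \<Rightarrow> ('a \<Rightarrow> 'm coord \<Rightarrow> complex) \<Rightarrow> 'a \<Rightarrow> 'm coord \<Rightarrow> complex" where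
  "vlift_form1 pr k \<omega> p b = (if b \<in> labels 0 then \<omega> (base_proj pr k p) b else 0)"

text \<open>\<open>\<Phi>\<^sup>v\<^sup>k = - d \<lambda>\<^sup>v\<^sup>k\<close>; for \<open>k = 0\<close> this is the form \<open>-d\<lambda>\<close> on \<open>M\<close>.\<close>

definition Phi_lift :: "(nat \<Rightarrow> 'a \<Rightarrow> 'a) \<Rightarrow> (nat \<Rightarrow> ('a, 'm::finite) chart) \<Rightarrow> nat \<Rightarrow>
    'a \<Rightarrow> 'm coord \<Rightarrow> 'm coord \<Rightarrow> complex" where
  "Phi_lift pr c k p a b = - ext_d1 (c k) k (vlift_form1 pr k (liouville (c 0))) p a b"

text \<open>
  The vertical lift of order \<open>k\<close> is the isomorphism \<open>\<partial>/\<partial>z\<^sub>0\<^sub>i \<mapsto> \<partial>/\<partial>z\<^sub>k\<^sub>i\<close> (and conjugates) onto the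
  bundle of vectors of top order; this is its inverse, the identity for \<open>k = 0\<close>.  The
  form \<open>\<Phi>\<^sup>v\<^sup>k\<close> involves only \<open>dz\<^sub>0\<^sub>i\<close> and conjugates, so for \<open>k > 0\<close> its interior product with
  a field of top order vanishes unless the field is first transported by this isomorphism.
\<close>

fun vert_iso_inv :: "nat \<Rightarrow> ('m coord \<Rightarrow> complex) \<Rightarrow> 'm coord \<Rightarrow> complex" where
  "vert_iso_inv k V (Hol s i) = (if s = 0 then V (Hol k i) else 0)"
| "vert_iso_inv k V (Anti s i) = (if s = 0 then V (Anti k i) else 0)"

end

theory Submission
  imports Defs
begin

text \<open>
  In the charts of an extension tower, moving a coordinate of level 0 moves the base point along the
  same coordinate, while moving a coordinate of positive level fixes it.  Hence the derivatives of a
  vertically lifted function are those of the function at level 0 and vanish at positive level, and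
  both Hamiltonian equations reduce to reading off the coefficients of
  \<open>-\<i> \<Sum>i. dz\<^sub>0\<^sub>i (conjugate) \<and> dz\<^sub>0\<^sub>i\<close>.
\<close>

section \<open>Coordinate labels and derivatives along real lines\<close>

lemma Hol_in_labels [simp]: "Hol s i \<in> labels r \<longleftrightarrow> s \<le> r"
  and Anti_in_labels [simp]: "Anti s i \<in> labels r \<longleftrightarrow> s \<le> r"
  by (auto simp: labels_def)

lemma finite_labels [simp]: "finite (labels r :: 'm::finite coord set)"
  by (simp add: labels_def)

lemma real_pd_cong_eventually:
  assumes "eventually (\<lambda>x::real. f (shift c s p (x *\<^sub>R v)) = g (shift c' s' p' (x *\<^sub>R v))) (nhds 0)"
  shows "real_pd c f s v p = real_pd c' g s' v p'"
  unfolding real_pd_def using assms by (intro vector_derivative_cong_eq) auto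

lemma real_pd_eqI:
  assumes "eventually (\<lambda>x::real. f (shift c s p (x *\<^sub>R v)) = g x) (nhds 0)"
    and "(g has_vector_derivative D) (at 0)"
  shows "real_pd c f s v p = D"
proof -
  have "real_pd c f s v p = vector_derivative g (at 0)"
    unfolding real_pd_def using assms(1) by (intro vector_derivative_cong_eq) auto
  then show ?thesis
    using vector_derivative_at[OF assms(2)] by simp
qed

section \<open>Charts and small coordinate shifts\<close>

lemma chart_inj_on:
  assumes "complex_manifold r T A" "c \<in> A"
  shows "inj_on (snd c) (fst c)"
proof -
  obtain W where op: "openin T (fst c)"
    and hom: "homeomorphic_map (subtopology T (fst c)) (subtopology (coord_space r) W) (snd c)"
    using assms unfolding complex_manifold_def by blast
  have "topspace (subtopology T (fst c)) = fst c"
    using op by (auto dest: openin_subset)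
  then show ?thesis
    using homeomorphic_imp_injective_map[OF hom] by simp
qed

lemma openin_chart_image:
  assumes "complex_manifold r T A" "c \<in> A"
  shows "openin (coord_space r) (snd c ` fst c)"
proof -
  obtain W where op: "openin T (fst c)" and W: "openin (coord_space r) W"
    and hom: "homeomorphic_map (subtopology T (fst c)) (subtopology (coord_space r) W) (snd c)"
    using assms unfolding complex_manifold_def by blast
  have "topspace (subtopology T (fst c)) = fst c"
       "topspace (subtopology (coord_space r) W) = W"
    using op W by (auto dest: openin_subset)
  then show ?thesis
    using homeomorphic_imp_surjective_map[OF hom] W by simp
qed

text \<open>The space \<open>coord_space r\<close> contains extensional families only, so
  coordinates are determined by their levels up to \<open>r\<close>.\<close>

lemma chart_extensional:
  assumes "complex_manifold r T A" "c \<in> A" "p \<in> fst c"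
  shows "snd c p \<in> extensional {..r}"
  using openin_subset[OF openin_chart_image[OF assms(1,2)]] assms(3)
  by (auto simp: coord_space_def PiE_def)

lemma continuous_map_coord_line:
  assumes "w \<in> extensional {..r}" "s \<le> r"
  shows "continuous_map euclideanreal (coord_space r) (\<lambda>x. w(s := w s + x *\<^sub>R v))"
  unfolding coord_space_def continuous_map_componentwise
proof (intro conjI ballI)
  show "(\<lambda>x. w(s := w s + x *\<^sub>R v)) ` topspace euclideanreal \<subseteq> extensional {..r}"
    using assms by (auto simp: extensional_def)
  show "continuous_map euclideanreal euclidean (\<lambda>x. (w(s := w s + x *\<^sub>R v)) j)" for j
    by (cases "j = s") (auto intro!: continuous_intros)
qed

text \<open>As \<open>shift\<close> is built from \<open>inv_into\<close>, it is meaningful only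
  while the shifted coordinates stay in the chart image. That image is open and the coordinate line
  continuous, so this holds for all small \<open>x\<close>, which is all that a derivative at 0
  sees.\<close>

lemma eventually_shift:
  assumes "complex_manifold r T A" "c \<in> A" "p \<in> fst c" "s \<le> r"
  shows "\<forall>\<^sub>F x::real in nhds 0. shift c s p (x *\<^sub>R v) \<in> fst c \<and>
           snd c (shift c s p (x *\<^sub>R v)) = (snd c p)(s := snd c p s + x *\<^sub>R v)"
proof -
  let ?l = "\<lambda>x::real. (snd c p)(s := snd c p s + x *\<^sub>R v)"
  have "openin euclideanreal {x \<in> topspace euclideanreal. ?l x \<in> snd c ` fst c}"
    using continuous_map_coord_line[OF chart_extensional[OF assms(1-3)] assms(4)]
      openin_chart_image[OF assms(1,2)]
    by (rule openin_continuous_map_preimage)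
  then have "open {x. ?l x \<in> snd c ` fst c}"
    by simp
  moreover have "0 \<in> {x. ?l x \<in> snd c ` fst c}"
    using assms(3) by simp
  ultimately have "\<forall>\<^sub>F x in nhds 0. ?l x \<in> snd c ` fst c"
    unfolding eventually_nhds by blast
  then show ?thesis
    by (rule eventually_mono) (simp add: shift_def inv_into_into f_inv_into_f)
qed

lemma shift_eqI:
  assumes "inj_on (snd c) (fst c)" "q \<in> fst c" "snd c q = (snd c p)(s := snd c p s + v)"
  shows "shift c s p v = q"
  using assms by (metis inv_into_f_f shift_def)

section \<open>Derivatives of the Liouville form\<close>

lemma real_pd_liouville:
  assumes "complex_manifold 0 T A" "c \<in> A" "p \<in> fst c"
  shows "real_pd c (\<lambda>q. liouville c q (Hol s i)) 0 v p =
           (if s = 0 then \<i> / 2 * cnj (v $ i) else 0)"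
    and "real_pd c (\<lambda>q. liouville c q (Anti s i)) 0 v p =
           (if s = 0 then - \<i> / 2 * v $ i else 0)"
proof -
  note ev = eventually_shift[OF assms le0, of v]
  \<comment> \<open>Along a coordinate line of level 0 the coefficients of \<open>liouville\<close>
    are affine in the real parameter.\<close>
  have scale: "((\<lambda>x::real. a * (b + of_real x * d)) has_vector_derivative a * d) (at 0)"
    for a b d :: complex
    by (auto intro!: derivative_eq_intros simp: scaleR_conv_of_real[symmetric])
  have "real_pd c (\<lambda>q. liouville c q (Hol 0 i)) 0 v p = \<i> / 2 * cnj (v $ i)"
    by (rule real_pd_eqI[OF _ scale[where b = "cnj (snd c p 0 $ i)"]])
       (use ev in eventually_elim, simp add: scaleR_conv_of_real[where 'a = complex])
  then show "real_pd c (\<lambda>q. liouville c q (Hol s i)) 0 v p =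
      (if s = 0 then \<i> / 2 * cnj (v $ i) else 0)"
    by (simp add: real_pd_def)
  have "real_pd c (\<lambda>q. liouville c q (Anti 0 i)) 0 v p = - \<i> / 2 * v $ i"
    by (rule real_pd_eqI[OF _ scale[where b = "snd c p 0 $ i"]])
       (use ev in eventually_elim, simp add: scaleR_conv_of_real[where 'a = complex])
  then show "real_pd c (\<lambda>q. liouville c q (Anti s i)) 0 v p =
      (if s = 0 then - \<i> / 2 * v $ i else 0)"
    by (simp add: real_pd_def)
qed

text \<open>Combining the directions 1 and \<i>, the holomorphic derivative keeps what is complex
  linear in \<open>v\<close> and kills what is antilinear; the antiholomorphic one does the
  opposite.\<close>

lemma pd_liouville:
  assumes "complex_manifold 0 T A" "c \<in> A" "p \<in> fst c"
  shows "pd c (\<lambda>q. liouville c q b) (Hol 0 i) p = (if b = Anti 0 i then - \<i> / 2 else 0)"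
    and "pd c (\<lambda>q. liouville c q b) (Anti 0 i) p = (if b = Hol 0 i then \<i> / 2 else 0)"
  by (cases b; simp add: real_pd_liouville[OF assms] axis_def del: liouville.simps)+

section \<open>Projection to the base in a tower of compatible charts\<close>

locale charted_tower =
  fixes k :: nat
    and X :: "nat \<Rightarrow> 'a topology"
    and A :: "nat \<Rightarrow> ('a, 'm::finite) chart set"
    and pr :: "nat \<Rightarrow> 'a \<Rightarrow> 'a"
    and c :: "nat \<Rightarrow> ('a, 'm) chart"
  assumes tower: "extension_tower k X A pr"
    and coords: "local_coordinates k X A pr c"
begin

lemma manifold: "r \<le> k \<Longrightarrow> complex_manifold r (X r) (A r)"
  using tower by (simp add: extension_tower_def)

lemma chart: "r \<le> k \<Longrightarrow> c r \<in> A r"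
  using coords by (simp add: local_coordinates_def)

text \<open>Each chart extension keeps all earlier coordinates, so the block of level 0 survives an
  induction down the tower.\<close>

lemma base_proj_chart:
  assumes "r \<le> k" "p \<in> fst (c r)"
  shows "base_proj pr r p \<in> fst (c 0)"
    and "snd (c 0) (base_proj pr r p) 0 = snd (c r) p 0"
proof -
  have "base_proj pr r p \<in> fst (c 0) \<and> snd (c 0) (base_proj pr r p) 0 = snd (c r) p 0"
    using assms
  proof (induction r arbitrary: p)
    case 0
    then show ?case by simp
  next
    case (Suc r)
    then have "extends_chart (X (Suc r)) (pr r) r (c r) (c (Suc r))"
      using coords by (simp add: local_coordinates_def)
    then have "pr r p \<in> fst (c r)" "snd (c (Suc r)) p 0 = snd (c r) (pr r p) 0"
      using Suc.prems by (auto simp: extends_chart_def)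
    then show ?case
      using Suc by simp
  qed
  then show "base_proj pr r p \<in> fst (c 0)"
    and "snd (c 0) (base_proj pr r p) 0 = snd (c r) p 0"
    by simp_all
qed

text \<open>A point of \<open>fst (c 0)\<close> is determined by its block of level 0, which the
  projection preserves. Moving a positive level leaves this block alone, hence the shift by 0 in
  that case.\<close>

lemma base_proj_shift:
  assumes "r \<le> k" "p \<in> fst (c r)" "s \<le> r"
  shows "\<forall>\<^sub>F x::real in nhds 0. base_proj pr r (shift (c r) s p (x *\<^sub>R v)) =
           shift (c 0) 0 (base_proj pr r p) (if s = 0 then x *\<^sub>R v else 0)"
  using eventually_shift[OF manifold[OF assms(1)] chart[OF assms(1)] assms(2,3), of v]
proof eventually_elim
  case (elim x)
  let ?q = "shift (c r) s p (x *\<^sub>R v)"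
  let ?v = "if s = 0 then x *\<^sub>R v else 0"
  have q: "?q \<in> fst (c r)" and coord: "snd (c r) ?q 0 = snd (c r) p 0 + ?v"
    using elim by auto
  note base = base_proj_chart(1)[OF assms(1)]
  note ext = chart_extensional[OF manifold[OF le0] chart[OF le0]]
  \<comment> \<open>Outside \<open>{..0}\<close> both families are \<open>undefined\<close>, so only
    level 0 has to be compared.\<close>
  have "snd (c 0) (base_proj pr r ?q) =
      (snd (c 0) (base_proj pr r p))(0 := snd (c 0) (base_proj pr r p) 0 + ?v)"
    using ext[OF base[OF q]] ext[OF base[OF assms(2)]] coord
      base_proj_chart(2)[OF assms(1) q] base_proj_chart(2)[OF assms(1,2)]
    by (intro extensionalityI[where A = "{..0}"]) (auto simp: extensional_def)
  then show ?case
    using shift_eqI[OF chart_inj_on[OF manifold[OF le0] chart[OF le0]] base[OF q]] by simp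
qed

lemma real_pd_base_proj:
  assumes "r \<le> k" "p \<in> fst (c r)" "s \<le> r"
  shows "real_pd (c r) (\<lambda>q. f (base_proj pr r q)) s v p =
           (if s = 0 then real_pd (c 0) f 0 v (base_proj pr r p) else 0)"
proof (cases "s = 0")
  case True
  have "real_pd (c r) (\<lambda>q. f (base_proj pr r q)) s v p = real_pd (c 0) f 0 v (base_proj pr r p)"
    by (rule real_pd_cong_eventually)
       (use base_proj_shift[OF assms, of v] in eventually_elim, simp add: True)
  then show ?thesis
    using True by simp
next
  case False
  \<comment> \<open>Near 0 the function is the constant value of \<open>f\<close> at the base point
    shifted by 0.\<close>
  have "real_pd (c r) (\<lambda>q. f (base_proj pr r q)) s v p = 0"
    by (rule real_pd_eqI[OF _ has_vector_derivative_const])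
       (use base_proj_shift[OF assms, of v] in eventually_elim, simp add: False)
  then show ?thesis
    using False by simp
qed

lemma pd_base_proj:
  assumes "r \<le> k" "p \<in> fst (c r)" "a \<in> labels r"
  shows "pd (c r) (\<lambda>q. f (base_proj pr r q)) a p =
           (if a \<in> labels 0 then pd (c 0) f a (base_proj pr r p) else 0)"
  using assms(3) by (cases a) (simp_all add: real_pd_base_proj[OF assms(1,2)])

section \<open>The lifted 2-form and its contractions\<close>

lemma vlift_liouville:
  "vlift_form1 pr r (liouville (c 0)) p b = liouville (c 0) (base_proj pr r p) b"
  by (cases b) (simp_all add: vlift_form1_def)

text \<open>The lifted Liouville form has only components of level 0, depending only on coordinates
  of level 0. For the pair \<open>Anti 0 j\<close>, \<open>Hol 0 j\<close> each of the two terms of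
  the exterior derivative contributes \<open>\<i> / 2\<close>; the sign in -d\<lambda> turns their
  sum into \<open>- \<i>\<close>.\<close>

lemma Phi_lift_components:
  assumes "r \<le> k" "p \<in> fst (c r)"
  shows "Phi_lift pr c r p a (Hol s j) = (if s = 0 \<and> a = Anti 0 j then - \<i> else 0)"
    and "Phi_lift pr c r p a (Anti s j) = (if s = 0 \<and> a = Hol 0 j then \<i> else 0)"
proof -
  have pd_lift: "pd (c r) (\<lambda>q. liouville (c 0) (base_proj pr r q) b) a p =
      (if a \<in> labels 0 then pd (c 0) (\<lambda>q. liouville (c 0) q b) a (base_proj pr r p) else 0)"
    if "a \<in> labels r" for a b
    using pd_base_proj[OF assms that] .
  note pd_base = pd_liouville[OF manifold[OF le0] chart[OF le0] base_proj_chart(1)[OF assms]]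
  show "Phi_lift pr c r p a (Hol s j) = (if s = 0 \<and> a = Anti 0 j then - \<i> else 0)"
    by (cases a) (auto simp: Phi_lift_def ext_d1_def vlift_liouville pd_lift pd_base
        simp del: pd.simps liouville.simps)
  show "Phi_lift pr c r p a (Anti s j) = (if s = 0 \<and> a = Hol 0 j then \<i> else 0)"
    by (cases a) (auto simp: Phi_lift_def ext_d1_def vlift_liouville pd_lift pd_base
        simp del: pd.simps liouville.simps)
qed

text \<open>For a fixed second label at most one entry of the form is nonzero, so the sum collapses
  to the component with the conjugate label. The instances \<open>r = 0\<close> and
  \<open>r = k\<close> serve the two Hamiltonian equations.\<close>

lemma interior_product_Phi_lift:
  assumes "r \<le> k" "p \<in> fst (c r)"
  shows "interior_product r V (Phi_lift pr c r p) (Hol s j) =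
           (if s = 0 then - \<i> * V (Anti 0 j) else 0)"
    and "interior_product r V (Phi_lift pr c r p) (Anti s j) =
           (if s = 0 then \<i> * V (Hol 0 j) else 0)"
  by (simp_all add: interior_product_def Phi_lift_components[OF assms] if_distrib[of "times _"]
        cong: if_cong)

end

text \<open>These are the entries that \<open>vert_iso_inv\<close> reads, so transporting the lift
  back recovers the components of \<open>V\<close> at the base point.\<close>

lemma vlift_field_top:
  "vlift_field pr k V p (Hol k i) = V (base_proj pr k p) (Hol 0 i)"
  "vlift_field pr k V p (Anti k i) = V (base_proj pr k p) (Anti 0 i)"
  by (simp_all add: vlift_field_def frame_def if_distrib[of "times _"] cong: if_cong)

theorem proposition1:
  fixes k :: nat
    and X :: "nat \<Rightarrow> 'a topology"
    and A :: "nat \<Rightarrow> ('a, 'm::finite) chart set"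
    and pr :: "nat \<Rightarrow> 'a \<Rightarrow> 'a"
    and c :: "nat \<Rightarrow> ('a, 'm) chart"
    and \<Phi> :: "('a, 'm) chart \<Rightarrow> 'a \<Rightarrow> 'm coord \<Rightarrow> 'm coord \<Rightarrow> complex"
    and H :: "real \<times> 'a \<Rightarrow> complex"
    and Z :: "real \<Rightarrow> ('a, 'm) chart \<Rightarrow> 'a \<Rightarrow> 'm coord \<Rightarrow> complex"
  assumes "kaehler_manifold (X 0) (A 0) \<Phi>"
    and "extension_tower k X A pr"
    and "local_coordinates k X A pr c"
    and "\<forall>p\<in>fst (c 0). \<forall>a\<in>labels 0. \<forall>b\<in>labels 0.
           \<Phi> (c 0) p a b = - ext_d1 (c 0) 0 (liouville (c 0)) p a b"
    and "smooth_hamiltonian (A 0) H"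
    and "\<forall>t. hamiltonian_field (A 0) \<Phi> (\<lambda>q. H (t, q)) (Z t)"
  shows "\<forall>t. \<forall>p\<in>fst (c k).
     vlift_field pr k (Z t (c 0)) p = (\<lambda>b.
       (\<Sum>i\<in>UNIV. (1 / \<i>) * pd (c k) (\<lambda>q. vlift_fun pr k H (t, q)) (Anti 0 i) p * frame (Hol k i) b) -
       (\<Sum>i\<in>UNIV. (1 / \<i>) * pd (c k) (\<lambda>q. vlift_fun pr k H (t, q)) (Hol 0 i) p * frame (Anti k i) b)) \<and>
     interior_product k (vert_iso_inv k (vlift_field pr k (Z t (c 0)) p)) (Phi_lift pr c k p) =
       ext_d0 (c k) k (\<lambda>q. vlift_fun pr k H (t, q)) p"
proof (intro allI ballI conjI)
  fix t p
  assume p: "p \<in> fst (c k)"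
  interpret charted_tower k X A pr c
    using assms(2,3) by unfold_locales
  define P where "P = base_proj pr k p"
  have P: "P \<in> fst (c 0)"
    using base_proj_chart(1)[OF order_refl p] by (simp add: P_def)
  let ?h = "\<lambda>q. H (t, q)"
  let ?H = "\<lambda>q. vlift_fun pr k H (t, q)"
  \<comment> \<open>The lift does not touch \<open>t\<close>, so at fixed \<open>t\<close> it is
    \<open>?h\<close> composed with the projection.\<close>
  have pdH: "pd (c k) ?H a p = (if a \<in> labels 0 then pd (c 0) ?h a P else 0)"
    if "a \<in> labels k" for a
    using pd_base_proj[OF order_refl p that, of ?h] by (simp add: vlift_fun_def P_def)
  \<comment> \<open>On the base, the given form is the order 0 instance of \<open>Phi_lift\<close>,
    so the computed contractions apply to \<open>\<Phi>\<close> as well.\<close>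
  have Phi: "\<Phi> (c 0) P a b = Phi_lift pr c 0 P a b" if "a \<in> labels 0" "b \<in> labels 0" for a b
    using assms(4) P that by (simp add: Phi_lift_def ext_d1_def vlift_liouville)
  have ham: "interior_product 0 (Z t (c 0) P) (Phi_lift pr c 0 P) b = pd (c 0) ?h b P"
    if "b \<in> labels 0" for b
  proof -
    have "interior_product 0 (Z t (c 0) P) (\<Phi> (c 0) P) b = ext_d0 (c 0) 0 ?h P b"
      using assms(6) chart[OF le0] P that by (simp add: hamiltonian_field_def)
    then show ?thesis
      using that by (simp add: interior_product_def ext_d0_def Phi)
  qed
  \<comment> \<open>Evaluating the Hamiltonian equation at a single label isolates the component of
    \<open>Z\<close> with the conjugate label.\<close>
  have Anti: "- \<i> * Z t (c 0) P (Anti 0 i) = pd (c 0) ?h (Hol 0 i) P" for i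
    using ham[of "Hol 0 i"] interior_product_Phi_lift(1)[OF le0 P] by simp
  have Hol: "\<i> * Z t (c 0) P (Hol 0 i) = pd (c 0) ?h (Anti 0 i) P" for i
    using ham[of "Anti 0 i"] interior_product_Phi_lift(2)[OF le0 P] by simp
  \<comment> \<open>The derivatives are rewritten back into components of \<open>Z\<close>: the
    factor \<open>1 / \<i>\<close> cancels \<i> in the first sum and gives -1 in the second, where
    the minus sign between the sums restores the plus of \<open>vlift_field\<close>.\<close>
  show "vlift_field pr k (Z t (c 0)) p = (\<lambda>b.
       (\<Sum>i\<in>UNIV. (1 / \<i>) * pd (c k) ?H (Anti 0 i) p * frame (Hol k i) b) -
       (\<Sum>i\<in>UNIV. (1 / \<i>) * pd (c k) ?H (Hol 0 i) p * frame (Anti k i) b))"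
    by (simp add: vlift_field_def pdH Anti[symmetric] Hol[symmetric] P_def[symmetric]
          sum_negf del: pd.simps)
  show "interior_product k (vert_iso_inv k (vlift_field pr k (Z t (c 0)) p)) (Phi_lift pr c k p) =
       ext_d0 (c k) k ?H p"
  proof
    \<comment> \<open>At level 0 this is the Hamiltonian equation on the base at \<open>P\<close>.
      At positive level the contraction vanishes; on the right \<open>pdH\<close> gives 0 up to
      level \<open>k\<close>, and beyond \<open>k\<close> the value is the default 0 of
      \<open>ext_d0\<close>.\<close>
    fix b
    show "interior_product k (vert_iso_inv k (vlift_field pr k (Z t (c 0)) p))
        (Phi_lift pr c k p) b = ext_d0 (c k) k ?H p b"
      by (cases b) (simp_all add: interior_product_Phi_lift[OF order_refl p] ext_d0_def pdH
          vlift_field_top Anti[symmetric] Hol[symmetric] P_def[symmetric] del: pd.simps)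
  qed
qed

end
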